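(* Let $v_1,v_2,\dots,v_5\in\mathbb{R}^3$ be $3$-independent. Let $F:\mathbb{R}^3\to\mathbb{R}^3$ be an injective mapping that maps each line in $\mathcal{L}(v_1,\dots,v_5)$ onto a line. Then $F$ is affine-additive. Moreover, there exist a basis $u_1,u_2,u_3$ of $\mathbb{R}^3$, a basis $w_1,w_2,w_3$ of $\mathbb{R}^3$, and additive bijections $f_1,f_2,f_3:\mathbb{R}\to\mathbb{R}$ with $f_i(1)=1$, such that for every $x=\sum_{i=1}^3\alpha_i u_i$, $$F(x)-F(0)=\sum_{i=1}^3 f_i(\alpha_i)w_i.$$
   Context: A line in $\mathbb{R}^n$ is a set of the form $a+\mathbb{R}b$ with $b\neq 0$; it is said to be parallel to $b$. $\mathcal{L}(v_1,\dots,v_k)$ denotes the family of all lines parallel to one of $v_1,\dots,v_k$. $F$ maps a line $l$ onto a line if $F(l)$ is equal to a line. Vectors are $j$-independent if every $j$ of them are linearly independent. A map $F$ is affine-additive if $x\mapsto F(x)-F(0)$ is additive. No continuity is assumed. *)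

theory Defs
  imports "HOL-Analysis.Analysis"
begin

definition line :: "'a::real_vector \<Rightarrow> 'a \<Rightarrow> 'a set" where
  "line a b = {a + t *\<^sub>R b | t. True}"

definition is_line :: "'a::real_vector set \<Rightarrow> bool" where
  "is_line l \<longleftrightarrow> (\<exists>a b. b \<noteq> 0 \<and> l = line a b)"

definition parallel_to :: "'a::real_vector set \<Rightarrow> 'a \<Rightarrow> bool" where
  "parallel_to l v \<longleftrightarrow> v \<noteq> 0 \<and> (\<exists>a. l = line a v)"

definition lines_parallel :: "('i \<Rightarrow> 'a::real_vector) \<Rightarrow> 'a set set" where
  "lines_parallel v = {l. \<exists>i. parallel_to l (v i)}"

text \<open>Linear independence of an indexed family: a repeated vector makes the family dependent,
  hence the injectivity condition.\<close>

definition independent_family_on :: "'i set \<Rightarrow> ('i \<Rightarrow> 'a::real_vector) \<Rightarrow> bool" where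
  "independent_family_on J v \<longleftrightarrow> inj_on v J \<and> independent (v ` J)"

definition j_independent :: "nat \<Rightarrow> ('i::finite \<Rightarrow> 'a::real_vector) \<Rightarrow> bool" where
  "j_independent j v \<longleftrightarrow> (\<forall>J. card J = j \<longrightarrow> independent_family_on J v)"

definition basis_family :: "('i \<Rightarrow> 'a::real_vector) \<Rightarrow> bool" where
  "basis_family u \<longleftrightarrow> independent_family_on UNIV u \<and> span (range u) = UNIV"

definition affine_additive :: "('a::real_vector \<Rightarrow> 'b::real_vector) \<Rightarrow> bool" where
  "affine_additive F \<longleftrightarrow> Modules.additive (\<lambda>x. F x - F 0)"

end

theory Submission
  imports Defs
begin

text \<open>
  Along a line in one of the given directions \<open>d\<close>, injectivity lets us write
  \<open>F (a + t d) = F a + \<phi> t (F (a + d) - F a)\<close> with a bijection \<open>\<phi>\<close> of \<open>\<real>\<close> fixing \<open>0\<close> and \<open>1\<close>. The main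
  point is that \<open>\<phi>\<close> depends on \<open>d\<close> alone. In a plane spanned by two of the directions, the images
  of the two families of parallel lines either lie in a plane or are the two rulings of a quadric surface.
  Since every point of each image line is met by the other family, the quadric can only be a hyperbolic
  paraboloid, and the correspondence between two lines of a ruling is affine
  (\<open>rulings_agree\<close>, \<open>induced_on_parallel_line\<close>). The other directions span the space, so \<open>\<phi>\<close> is the same
  on all lines along \<open>d\<close>. Comparing base points on one line then gives a functional equation whose only
  bijective solutions are additive (\<open>additive_of_translation_rule\<close>, \<open>induced_uniformly\<close>).

  Take as a basis multiples \<open>e1\<close>, \<open>e2\<close>, \<open>e3\<close> of three of the vectors, such that a fourth one is
  \<open>e1 + e2 + e3\<close>. Then \<open>F\<close> is a polynomial, affine in each variable, in the transformed coordinates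
  \<open>f1 x\<close>, \<open>f2 y\<close>, \<open>f3 z\<close>. The theorem says that its terms of degree two and three vanish. The fourth
  and fifth directions eliminate the cubic term and, if quadratic terms are present, force them to be
  a single nondegenerate quadratic form times a fixed vector. This form is a genuine obstruction: with \<open>q\<close>
  a form vanishing on all five vectors, \<open>x + q(x) a\<close> does send the lines in question onto lines
  whenever it does not collapse them to points. What rules it out is injectivity
  (\<open>linear_plus_quadratic_not_inj\<close>, \<open>two_diagonal_directions_force_affine\<close>). The surviving linear terms
  are the asserted form of \<open>F\<close>.
\<close>

section \<open>The parametrization induced on a line\<close>

definition maps_direction :: "('a::real_vector \<Rightarrow> 'b::real_vector) \<Rightarrow> 'a \<Rightarrow> bool" where
  "maps_direction F d \<longleftrightarrow> d \<noteq> 0 \<and> (\<forall>a. is_line (F ` line a d))"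

text \<open>
  The scale on the image line is the one in which \<open>F a\<close> sits at \<open>0\<close> and \<open>F (a + d)\<close> at \<open>1\<close>. For
  injective \<open>F\<close> and \<open>d \<noteq> 0\<close> this makes \<open>\<phi>\<close> unique, so that comparing two parallel lines means comparing
  two real functions.
\<close>

definition induced_on_line ::
  "('a::real_vector \<Rightarrow> 'b::real_vector) \<Rightarrow> 'a \<Rightarrow> 'a \<Rightarrow> (real \<Rightarrow> real) \<Rightarrow> bool" where
  "induced_on_line F a d \<phi> \<longleftrightarrow> bij \<phi> \<and> \<phi> 0 = 0 \<and> \<phi> 1 = 1 \<and>
     (\<forall>t. F (a + t *\<^sub>R d) = F a + \<phi> t *\<^sub>R (F (a + d) - F a))"

lemma maps_direction_scale:
  assumes "maps_direction F d" "c \<noteq> 0"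
  shows "maps_direction F (c *\<^sub>R d)"
proof -
  have "line a (c *\<^sub>R d) = line a d" for a
  proof -
    have "\<exists>s. a + t *\<^sub>R d = a + s *\<^sub>R c *\<^sub>R d" for t
      by (rule exI[of _ "t / c"]) (use assms(2) in simp)
    moreover have "\<exists>s. a + t *\<^sub>R c *\<^sub>R d = a + s *\<^sub>R d" for t
      by (rule exI[of _ "t * c"]) simp
    ultimately show ?thesis unfolding line_def by blast
  qed
  then show ?thesis using assms by (simp add: maps_direction_def)
qed

lemma induced_on_line_exists:
  assumes "inj F" "maps_direction F d"
  shows "\<exists>\<phi>. induced_on_line F a d \<phi>"
proof -
  obtain p b where b: "b \<noteq> 0" "F ` line a d = line p b"
    using assms(2) unfolding maps_direction_def is_line_def by blast
  have d: "d \<noteq> 0" using assms(2) by (simp add: maps_direction_def)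
  have "\<exists>\<tau>. F (a + t *\<^sub>R d) = p + \<tau> *\<^sub>R b" for t
  proof -
    have "F (a + t *\<^sub>R d) \<in> F ` line a d" unfolding line_def by blast
    then have "F (a + t *\<^sub>R d) \<in> line p b" by (simp add: b(2))
    then show ?thesis unfolding line_def by blast
  qed
  then obtain g where g: "\<And>t. F (a + t *\<^sub>R d) = p + g t *\<^sub>R b" by metis
  have inj: "inj g"
  proof (rule injI)
    fix s t assume "g s = g t"
    then have "F (a + s *\<^sub>R d) = F (a + t *\<^sub>R d)" by (simp add: g)
    then have "s *\<^sub>R d = t *\<^sub>R d" using injD[OF assms(1)] by fastforce
    then show "s = t" using d by simp
  qed
  have surj: "\<exists>t. g t = \<tau>" for \<tau>
  proof -
    have "p + \<tau> *\<^sub>R b \<in> line p b" unfolding line_def by blast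
    then have "p + \<tau> *\<^sub>R b \<in> F ` line a d" by (simp add: b(2))
    then obtain t where "p + \<tau> *\<^sub>R b = F (a + t *\<^sub>R d)" unfolding line_def by blast
    then show ?thesis using b(1) by (auto simp: g)
  qed
  define k where "k = g 1 - g 0"
  have k: "k \<noteq> 0" using inj_eq[OF inj, of 1 0] by (simp add: k_def)
  define \<phi> where "\<phi> t = (g t - g 0) / k" for t
  have "bij \<phi>"
  proof (rule bijI)
    show "inj \<phi>" using k by (auto simp: inj_def \<phi>_def intro: injD[OF inj])
    show "surj \<phi>"
    proof (rule surjI)
      fix \<tau> show "\<phi> (SOME t. g t = g 0 + k * \<tau>) = \<tau>"
        using someI_ex[OF surj[of "g 0 + k * \<tau>"]] k by (simp add: \<phi>_def)
    qed
  qed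
  moreover have "F (a + t *\<^sub>R d) = F a + \<phi> t *\<^sub>R (F (a + d) - F a)" for t
  proof -
    have 0: "F a = p + g 0 *\<^sub>R b" using g[of 0] by simp
    have 1: "F (a + d) = p + g 1 *\<^sub>R b" using g[of 1] by simp
    have "F (a + d) - F a = k *\<^sub>R b" unfolding 0 1 k_def by (simp add: algebra_simps)
    then have "\<phi> t *\<^sub>R (F (a + d) - F a) = (g t - g 0) *\<^sub>R b" using k by (simp add: \<phi>_def)
    then show ?thesis unfolding 0 g by (simp add: algebra_simps)
  qed
  ultimately show ?thesis
    using k unfolding induced_on_line_def by (intro exI[of _ \<phi>]) (auto simp: \<phi>_def k_def)
qed

section \<open>Parallel lines carry the same parametrization\<close>

text \<open>
  The coefficients come from solving the normal equations of the Gram matrix of \<open>x\<close> and \<open>y\<close>, whose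
  determinant is the squared length of their cross product.
\<close>

lemma in_span_if_orthogonal_to_cross3:
  assumes "n = cross3 x y" "n \<noteq> 0" "z \<bullet> n = 0"
  shows "\<exists>\<alpha> \<beta>. z = \<alpha> *\<^sub>R x + \<beta> *\<^sub>R y"
proof -
  define N where "N = n \<bullet> n"
  have N: "N \<noteq> 0" using assms(2) by (simp add: N_def)
  have c: "z \<bullet> cross3 x y = 0" using assms by simp
  define \<alpha> where "\<alpha> = (z \<bullet> x) * (y \<bullet> y) - (z \<bullet> y) * (x \<bullet> y)"
  define \<beta> where "\<beta> = (z \<bullet> y) * (x \<bullet> x) - (z \<bullet> x) * (x \<bullet> y)"
  have "N *\<^sub>R z = \<alpha> *\<^sub>R x + \<beta> *\<^sub>R y"
    unfolding vec_eq_iff forall_3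
  proof (intro conjI)
    note c' = c[unfolded cross3_def inner_vec_def sum_3, simplified]
    show "(N *\<^sub>R z) $ 1 = (\<alpha> *\<^sub>R x + \<beta> *\<^sub>R y) $ 1"
      using c' by (simp add: N_def \<alpha>_def \<beta>_def assms(1) cross3_def inner_vec_def sum_3) algebra
    show "(N *\<^sub>R z) $ 2 = (\<alpha> *\<^sub>R x + \<beta> *\<^sub>R y) $ 2"
      using c' by (simp add: N_def \<alpha>_def \<beta>_def assms(1) cross3_def inner_vec_def sum_3) algebra
    show "(N *\<^sub>R z) $ 3 = (\<alpha> *\<^sub>R x + \<beta> *\<^sub>R y) $ 3"
      using c' by (simp add: N_def \<alpha>_def \<beta>_def assms(1) cross3_def inner_vec_def sum_3) algebra
  qed
  then have "(1 / N) *\<^sub>R N *\<^sub>R z = (\<alpha> / N) *\<^sub>R x + (\<beta> / N) *\<^sub>R y"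
    by (simp add: scaleR_add_right)
  then have "z = (\<alpha> / N) *\<^sub>R x + (\<beta> / N) *\<^sub>R y" using N by simp
  then show ?thesis by blast
qed

text \<open>
  The lines \<open>p\<^sub>i + \<real> b\<^sub>i\<close> play the part of three images of parallel lines, and the lines joining
  \<open>p0 + x b0\<close> to \<open>p1 + \<phi> x b1\<close> that of the images of the transversals. If the first two lines are
  parallel, each transversal must avoid the transversal at \<open>x = 0\<close> in the common plane, so it is
  parallel to it and \<open>\<phi>\<close> preserves ratios. Otherwise the transversals sweep out a ruled
  quadric through the three lines. Coplanarity of a transversal with the third line is
  a relation \<open>\<alpha> + \<beta> x + \<gamma> \<phi> x + \<delta> x (\<phi> x) = 0\<close>, so \<open>\<phi>\<close> is a fractional linear map; being defined on
  all of \<open>\<real>\<close> and injective it is affine (a hyperbolic paraboloid rather than a hyperboloid of one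
  sheet), hence the identity, because it fixes \<open>0\<close> and \<open>1\<close>.
\<close>

lemma rulings_agree:
  fixes p0 b0 p1 b1 p2 b2 :: "real^3" and \<phi> \<xi> m :: "real \<Rightarrow> real"
  assumes "bij \<phi>" "\<phi> 0 = 0" "\<phi> 1 = 1" "\<xi> 0 = 0" "\<xi> 1 = 1"
    and "b1 \<noteq> 0"
    and transversal: "\<And>x. p2 + \<xi> x *\<^sub>R b2 =
          p0 + x *\<^sub>R b0 + m x *\<^sub>R (p1 + \<phi> x *\<^sub>R b1 - (p0 + x *\<^sub>R b0))"
    and m: "\<And>x. m x \<noteq> 0" "\<And>x. m x \<noteq> 1"
    and disjoint01: "\<And>x y. p0 + x *\<^sub>R b0 \<noteq> p1 + y *\<^sub>R b1"
    and disjoint12: "\<And>x y. p1 + x *\<^sub>R b1 \<noteq> p2 + y *\<^sub>R b2"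
    and disjoint_transversals: "\<And>x \<sigma> \<tau>. x \<noteq> 0 \<Longrightarrow>
          p0 + \<sigma> *\<^sub>R (p1 - p0) \<noteq> p0 + x *\<^sub>R b0 + \<tau> *\<^sub>R (p1 + \<phi> x *\<^sub>R b1 - (p0 + x *\<^sub>R b0))"
  shows "\<phi> x = x"
proof (cases "\<exists>\<rho>. b0 = \<rho> *\<^sub>R b1")
  case True
  then obtain \<rho> where \<rho>: "b0 = \<rho> *\<^sub>R b1" by blast
  have *: "\<phi> x = \<rho> * x" if "x \<noteq> 0" for x
  proof (rule ccontr)
    assume ne: "\<phi> x \<noteq> \<rho> * x"
    \<comment> \<open>the parameter at which the transversal through \<open>x\<close> would meet the one through \<open>0\<close>\<close>
    define \<tau> where "\<tau> = \<rho> * x / (\<rho> * x - \<phi> x)"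
    have "(1 - \<tau>) * (x * \<rho>) + \<tau> * \<phi> x = 0"
      using ne unfolding \<tau>_def by (simp add: field_simps)
    then have "((1 - \<tau>) * (x * \<rho>) + \<tau> * \<phi> x) *\<^sub>R b1 = 0" by simp
    then have "p0 + \<tau> *\<^sub>R (p1 - p0) =
        p0 + x *\<^sub>R b0 + \<tau> *\<^sub>R (p1 + \<phi> x *\<^sub>R b1 - (p0 + x *\<^sub>R b0))"
      unfolding \<rho> by (simp add: algebra_simps)
    then show False using disjoint_transversals[OF that] by blast
  qed
  have "\<rho> = 1" using *[of 1] assms(3) by simp
  then show ?thesis using * assms(2) by (cases "x = 0") auto
next
  case False
  then have np: "b0 \<noteq> \<rho> *\<^sub>R b1" for \<rho> by blast
  \<comment> \<open>If the last two lines were parallel, the first would lie in their plane and meet the second.\<close>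
  have "b2 \<noteq> \<kappa> *\<^sub>R b1" for \<kappa>
  proof
    assume k: "b2 = \<kappa> *\<^sub>R b1"
    have 0: "p2 = p0 + m 0 *\<^sub>R (p1 - p0)" using transversal[of 0] assms by simp
    have 1: "p2 + b2 = p0 + b0 + m 1 *\<^sub>R (p1 + b1 - (p0 + b0))"
      using transversal[of 1] assms by simp
    have 2: "(\<kappa> - m 1) *\<^sub>R b1 - (1 - m 1) *\<^sub>R b0 = (m 1 - m 0) *\<^sub>R (p1 - p0)"
      using 1 unfolding 0 k by (simp add: algebra_simps)
    show False
    proof (cases "m 1 = m 0")
      case True
      then have "(1 - m 1) *\<^sub>R b0 = (\<kappa> - m 1) *\<^sub>R b1" using 2 by simp
      then have "(1 / (1 - m 1)) *\<^sub>R (1 - m 1) *\<^sub>R b0 = ((\<kappa> - m 1) / (1 - m 1)) *\<^sub>R b1"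
        by simp
      then have "b0 = ((\<kappa> - m 1) / (1 - m 1)) *\<^sub>R b1"
        using m(2)[of 1] by simp
      then show False using np by blast
    next
      case ne: False
      define \<mu> where "\<mu> = m 1 - m 0"
      have \<mu>: "\<mu> \<noteq> 0" using ne by (simp add: \<mu>_def)
      have "p1 - p0 = ((\<kappa> - m 1) / \<mu>) *\<^sub>R b1 - ((1 - m 1) / \<mu>) *\<^sub>R b0"
      proof -
        have "\<mu> *\<^sub>R (p1 - p0) = \<mu> *\<^sub>R (((\<kappa> - m 1) / \<mu>) *\<^sub>R b1 - ((1 - m 1) / \<mu>) *\<^sub>R b0)"
          using 2 \<mu> by (simp add: scaleR_diff_right \<mu>_def)
        then show ?thesis using \<mu> by simp
      qed
      then have "p0 + (- ((1 - m 1) / \<mu>)) *\<^sub>R b0 = p1 + (- ((\<kappa> - m 1) / \<mu>)) *\<^sub>R b1"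
        by (simp add: algebra_simps)
      then show False using disjoint01 by blast
    qed
  qed
  then have n: "cross3 b1 b2 \<noteq> 0"
    using \<open>b1 \<noteq> 0\<close> by (auto simp: cross_eq_0 collinear_lemma)
      (metis scaleR_zero_left)
  define A where "A = p0 - p2"
  define C where "C = p1 - p2"
  define \<alpha> where "\<alpha> = A \<bullet> cross3 C b2"
  define \<beta> where "\<beta> = b0 \<bullet> cross3 C b2"
  define \<gamma> where "\<gamma> = A \<bullet> cross3 b1 b2"
  define \<delta> where "\<delta> = b0 \<bullet> cross3 b1 b2"
  have rel: "\<alpha> + \<beta> * x + \<gamma> * \<phi> x + \<delta> * x * \<phi> x = 0" for x
  proof -
    define X where "X = A + x *\<^sub>R b0"
    define Y where "Y = C + \<phi> x *\<^sub>R b1"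
    have "\<xi> x *\<^sub>R b2 = (1 - m x) *\<^sub>R X + m x *\<^sub>R Y"
      using transversal[of x] unfolding X_def Y_def A_def C_def by (simp add: algebra_simps)
    then have "(\<xi> x *\<^sub>R b2) \<bullet> cross3 Y b2 = ((1 - m x) *\<^sub>R X + m x *\<^sub>R Y) \<bullet> cross3 Y b2"
      by simp
    then have "(1 - m x) * (X \<bullet> cross3 Y b2) = 0"
      by (simp add: inner_add_left dot_cross_self)
    then have "X \<bullet> cross3 Y b2 = 0" using m(2)[of x] by simp
    then show ?thesis
      unfolding X_def Y_def \<alpha>_def \<beta>_def \<gamma>_def \<delta>_def
      by (simp add: cross_add_left cross_mult_left inner_add_left inner_add_right algebra_simps)
  qed
  \<comment> \<open>With \<open>\<delta> \<noteq> 0\<close> the relation at the pole \<open>x = - \<gamma> / \<delta>\<close> forces it to factor, so that \<open>\<phi>\<close> would be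
    constant off the pole.\<close>
  have "\<delta> = 0"
  proof (rule ccontr)
    assume \<delta>: "\<delta> \<noteq> 0"
    define z where "z = - \<gamma> / \<delta>"
    have z: "\<gamma> + \<delta> * z = 0" using \<delta> by (simp add: z_def)
    have "\<alpha> + \<beta> * z = 0" using rel[of z] z by algebra
    then have "(\<gamma> + \<delta> * x) * (\<delta> * \<phi> x + \<beta>) = 0" for x
      using rel[of x] z by algebra
    then have "\<phi> x = - \<beta> / \<delta>" if "x \<noteq> z" for x
      using that z \<delta> by (metis add.inverse_inverse add_eq_0_iff mult_eq_0_iff mult_left_cancel nonzero_mult_div_cancel_left)
    then have "\<phi> (z + 1) = \<phi> (z + 2)" by simp
    then show False using bij_is_inj[OF assms(1)] by (simp add: inj_eq)
  qed
  then have \<alpha>: "\<alpha> = 0" using rel[of 0] assms by simp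
  have "\<beta> = - \<gamma>" using rel[of 1] \<alpha> \<open>\<delta> = 0\<close> assms by simp
  then have "\<gamma> * (\<phi> x - x) = 0" using rel[of x] \<alpha> \<open>\<delta> = 0\<close> by (simp add: algebra_simps)
  \<comment> \<open>If \<open>\<gamma> = 0\<close>, then \<open>p0\<close> lies in the plane through \<open>p2\<close> spanned by \<open>b1\<close> and \<open>b2\<close>, and the transversal
    at \<open>0\<close> carries \<open>p1\<close> into it, so that the last two lines meet.\<close>
  moreover have "\<gamma> \<noteq> 0"
  proof
    assume "\<gamma> = 0"
    have "(1 - m 0) *\<^sub>R A + m 0 *\<^sub>R C = 0"
      using transversal[of 0] assms unfolding A_def C_def by (simp add: algebra_simps)
    then have "((1 - m 0) *\<^sub>R A + m 0 *\<^sub>R C) \<bullet> cross3 b1 b2 = 0" by simp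
    then have "m 0 * (C \<bullet> cross3 b1 b2) = 0"
      using \<open>\<gamma> = 0\<close> by (simp add: inner_add_left \<gamma>_def)
    then have "C \<bullet> cross3 b1 b2 = 0" using m by simp
    then obtain r s where "C = r *\<^sub>R b1 + s *\<^sub>R b2"
      using in_span_if_orthogonal_to_cross3[OF refl n] by blast
    then have "p1 + (- r) *\<^sub>R b1 = p2 + s *\<^sub>R b2" by (simp add: C_def algebra_simps)
    then show False using disjoint12 by blast
  qed
  ultimately show ?thesis by simp
qed

text \<open>
  In the plane through \<open>a\<close> spanned by \<open>d\<close> and \<open>e\<close>, the lines along \<open>d\<close> through \<open>a\<close>, \<open>a + e\<close>, \<open>a + 2 e\<close>
  supply the three lines of the previous lemma and the lines along \<open>e\<close> its transversals. All
  disjointness required there is injectivity of \<open>F\<close>.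
\<close>

lemma induced_on_parallel_line:
  fixes F :: "'a::real_vector \<Rightarrow> real^3"
  assumes F: "inj F" and d: "maps_direction F d" and e: "maps_direction F e"
    and de: "\<And>c. d \<noteq> c *\<^sub>R e"
    and \<phi>: "induced_on_line F a d \<phi>" and \<psi>: "induced_on_line F (a + e) d \<psi>"
  shows "\<psi> = \<phi>"
proof -
  have d0: "d \<noteq> 0" and e0: "e \<noteq> 0" using d e by (auto simp: maps_direction_def)
  have F_eq: "F x = F y \<longleftrightarrow> x = y" for x y using F by (simp add: inj_eq)
  obtain \<theta> where \<theta>: "induced_on_line F (a + 2 *\<^sub>R e) d \<theta>"
    using induced_on_line_exists[OF F d] by blast
  have "\<exists>\<omega>. induced_on_line F (a + t *\<^sub>R d) e \<omega>" for t
    using induced_on_line_exists[OF F e] by blast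
  then obtain \<omega> where \<omega>: "\<And>t. induced_on_line F (a + t *\<^sub>R d) e (\<omega> t)" by metis
  have b\<phi>: "bij \<phi>" and b\<psi>: "bij \<psi>" and b\<theta>: "bij \<theta>" and b\<omega>: "\<And>t. bij (\<omega> t)"
    using \<phi> \<psi> \<theta> \<omega> by (auto simp: induced_on_line_def)
  \<comment> \<open>Reparametrizing by the inverse of \<open>\<phi>\<close> makes the image of the first line run at unit speed.\<close>
  define T where "T = inv \<phi>"
  have T: "\<phi> (T x) = x" "T (\<phi> x) = x" for x
    using b\<phi> by (simp_all add: T_def bij_is_surj surj_f_inv_f bij_is_inj)
  have T01: "T 0 = 0" "T 1 = 1" using T(2)[of 0] T(2)[of 1] \<phi> by (auto simp: induced_on_line_def)
  define p0 p1 p2 where p: "p0 = F a" "p1 = F (a + e)" "p2 = F (a + 2 *\<^sub>R e)"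
  define b0 b1 b2 where b: "b0 = F (a + d) - F a" "b1 = F (a + e + d) - F (a + e)"
    "b2 = F (a + 2 *\<^sub>R e + d) - F (a + 2 *\<^sub>R e)"
  have L0: "F (a + T x *\<^sub>R d) = p0 + x *\<^sub>R b0" for x
    using \<phi> T by (simp add: induced_on_line_def p b)
  have L1: "F (a + e + t *\<^sub>R d) = p1 + \<psi> t *\<^sub>R b1" for t
    using \<psi> by (simp add: induced_on_line_def p b)
  have L2: "F (a + 2 *\<^sub>R e + t *\<^sub>R d) = p2 + \<theta> t *\<^sub>R b2" for t
    using \<theta> by (simp add: induced_on_line_def p b)
  have M: "F (a + T x *\<^sub>R d + s *\<^sub>R e) =
      p0 + x *\<^sub>R b0 + \<omega> (T x) s *\<^sub>R (p1 + \<psi> (T x) *\<^sub>R b1 - (p0 + x *\<^sub>R b0))" for x s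
    using \<omega>[of "T x"] L1[of "T x"] by (simp add: induced_on_line_def L0 add_ac)
  have \<omega>_ne: "\<omega> t 2 \<noteq> 0" "\<omega> t 2 \<noteq> 1" for t
  proof -
    have "\<omega> t 0 = 0" "\<omega> t 1 = 1" using \<omega> by (auto simp: induced_on_line_def)
    then show "\<omega> t 2 \<noteq> 0" "\<omega> t 2 \<noteq> 1"
      using inj_eq[OF bij_is_inj[OF b\<omega>[of t]], of 2 0] inj_eq[OF bij_is_inj[OF b\<omega>[of t]], of 2 1]
      by auto
  qed
  have surj: "\<exists>t. h t = y" if "bij h" for h :: "real \<Rightarrow> real" and y
    using that by (metis bij_pointE)
  have de': "s *\<^sub>R d \<noteq> s' *\<^sub>R e" if "s' \<noteq> 0 \<or> s \<noteq> 0" for s s'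
  proof
    assume eq: "s *\<^sub>R d = s' *\<^sub>R e"
    then have "s \<noteq> 0" using that e0 by auto
    then have "d = (1 / s) *\<^sub>R s *\<^sub>R d" by simp
    then have "d = (s' / s) *\<^sub>R e" unfolding eq by simp
    then show False using de by blast
  qed
  have rul: "\<psi> (T x) = x" for x
  proof (rule rulings_agree[where \<phi> = "\<lambda>x. \<psi> (T x)" and \<xi> = "\<lambda>x. \<theta> (T x)"
        and m = "\<lambda>x. \<omega> (T x) 2" and ?p0.0 = p0 and ?p1.0 = p1 and ?p2.0 = p2
        and ?b0.0 = b0 and ?b1.0 = b1 and ?b2.0 = b2])
    show "bij (\<lambda>x. \<psi> (T x))"
      using bij_comp[OF bij_imp_bij_inv[OF b\<phi>] b\<psi>] by (simp add: T_def comp_def)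
    show "\<psi> (T 0) = 0" "\<psi> (T 1) = 1" "\<theta> (T 0) = 0" "\<theta> (T 1) = 1"
      using \<psi> \<theta> T01 by (auto simp: induced_on_line_def)
    show "b1 \<noteq> 0" using d0 by (simp add: b F_eq)
    show "p2 + \<theta> (T x) *\<^sub>R b2 = p0 + x *\<^sub>R b0 +
        \<omega> (T x) 2 *\<^sub>R (p1 + \<psi> (T x) *\<^sub>R b1 - (p0 + x *\<^sub>R b0))" for x
      using M[of x 2] L2[of "T x"] by (simp add: add_ac)
    show "\<omega> (T x) 2 \<noteq> 0" "\<omega> (T x) 2 \<noteq> 1" for x using \<omega>_ne by auto
    show "p0 + x *\<^sub>R b0 \<noteq> p1 + y *\<^sub>R b1" for x y
    proof -
      obtain t where t: "\<psi> t = y" using surj[OF b\<psi>] by blast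
      have "a + T x *\<^sub>R d \<noteq> a + e + t *\<^sub>R d"
        using de'[of 1 "T x - t"] by (simp add: algebra_simps)
      then show ?thesis using L0[of x] L1[of t] F_eq t by metis
    qed
    show "p1 + x *\<^sub>R b1 \<noteq> p2 + y *\<^sub>R b2" for x y
    proof -
      obtain s where s: "\<psi> s = x" using surj[OF b\<psi>] by blast
      obtain t where t: "\<theta> t = y" using surj[OF b\<theta>] by blast
      have "a + e + s *\<^sub>R d \<noteq> a + 2 *\<^sub>R e + t *\<^sub>R d"
      proof
        assume "a + e + s *\<^sub>R d = a + 2 *\<^sub>R e + t *\<^sub>R d"
        then have "(s - t) *\<^sub>R d = 1 *\<^sub>R e" by (simp add: algebra_simps scaleR_2)
        then show False using de'[of 1 "s - t"] by simp
      qed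
      then show ?thesis using L1[of s] L2[of t] F_eq s t by metis
    qed
    show "p0 + \<sigma> *\<^sub>R (p1 - p0) \<noteq>
        p0 + x *\<^sub>R b0 + \<tau> *\<^sub>R (p1 + \<psi> (T x) *\<^sub>R b1 - (p0 + x *\<^sub>R b0))"
      if "x \<noteq> 0" for x \<sigma> \<tau>
    proof -
      obtain s where s: "\<omega> (T 0) s = \<sigma>" using surj[OF b\<omega>] by blast
      obtain s' where s': "\<omega> (T x) s' = \<tau>" using surj[OF b\<omega>] by blast
      have "T x \<noteq> 0" using that T(1)[of x] \<phi> by (auto simp: induced_on_line_def)
      have "a + T 0 *\<^sub>R d + s *\<^sub>R e \<noteq> a + T x *\<^sub>R d + s' *\<^sub>R e"
      proof
        assume "a + T 0 *\<^sub>R d + s *\<^sub>R e = a + T x *\<^sub>R d + s' *\<^sub>R e"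
        then have "T x *\<^sub>R d = (s - s') *\<^sub>R e" by (simp add: algebra_simps T01)
        then show False using de'[of "s - s'" "T x"] \<open>T x \<noteq> 0\<close> by blast
      qed
      then have "F (a + T 0 *\<^sub>R d + s *\<^sub>R e) \<noteq> F (a + T x *\<^sub>R d + s' *\<^sub>R e)"
        by (simp add: F_eq)
      moreover have "\<psi> 0 = 0" using \<psi> by (simp add: induced_on_line_def)
      ultimately show ?thesis unfolding M s s' by (simp add: T01)
    qed
  qed
  show ?thesis
  proof
    fix t show "\<psi> t = \<phi> t" using rul[of "\<phi> t"] T by simp
  qed
qed

section \<open>Additivity along each direction\<close>

text \<open>
  Symmetry in \<open>s\<close> and \<open>t\<close> turns the rule into \<open>f (s + t) = f s + f t + c (f s) (f t)\<close>. For \<open>c \<noteq> 0\<close> the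
  function \<open>1 + c f\<close> would turn sums into products, so each of its values would be a square, which a
  surjection onto \<open>\<real>\<close> does not allow.
\<close>

lemma additive_of_translation_rule:
  fixes f :: "real \<Rightarrow> real"
  assumes "surj f" "f 1 = 1"
    and rule: "\<And>s t. f (s + t) = f s + f t * (f (s + 1) - f s)"
  shows "Modules.additive f"
proof -
  define c where "c = f (1 + 1) - f 1 - 1"
  have g: "f (s + 1) - f s = 1 + c * f s" for s
    using rule[of s 1] rule[of 1 s] assms(2) by (simp add: c_def add.commute algebra_simps)
  then have rule': "f (s + t) = f s + f t + c * f s * f t" for s t
    using rule[of s t] unfolding g by (simp add: algebra_simps)
  have "c = 0"
  proof (rule ccontr)
    assume c: "c \<noteq> 0"
    \<comment> \<open>the point where \<open>1 + c f\<close> takes the value \<open>-1\<close>\<close>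
    obtain s where s: "f s = - 2 / c" using assms(1) by (metis surjD)
    have "1 + c * f s = (1 + c * f (s / 2))\<^sup>2"
      using rule'[of "s / 2" "s / 2"] by (simp add: power2_eq_square algebra_simps)
    moreover have "1 + c * f s = -1" using s c by simp
    ultimately show False by (metis zero_le_power2 neg_0_le_iff_le not_one_le_zero)
  qed
  then show ?thesis using rule' by (simp add: Modules.additive_def)
qed

text \<open>
  Moving the base point along the directions in \<open>E\<close> does not change the parametrization, and these
  directions reach every point. In particular the base point may move along \<open>d\<close> itself, which is
  exactly the rule of the previous lemma.
\<close>

lemma induced_uniformly:
  fixes F :: "'a::real_vector \<Rightarrow> real^3"
  assumes F: "inj F" and d: "maps_direction F d"
    and e: "\<And>e. e \<in> E \<Longrightarrow> maps_direction F e" "\<And>e c. e \<in> E \<Longrightarrow> d \<noteq> c *\<^sub>R e"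
    and E: "span E = UNIV"
  shows "\<exists>f. Modules.additive f \<and> bij f \<and> f 1 = 1 \<and>
    (\<forall>a t. F (a + t *\<^sub>R d) = F a + f t *\<^sub>R (F (a + d) - F a))"
proof -
  obtain \<phi> where \<phi>: "\<And>a. induced_on_line F a d (\<phi> a)"
    using induced_on_line_exists[OF F d] by metis
  have step: "\<phi> (a + c *\<^sub>R e) = \<phi> a" if "e \<in> E" for a c e
  proof (cases "c = 0")
    case False
    then show ?thesis
      using induced_on_parallel_line[OF F d maps_direction_scale[OF e(1)[OF that] False] _ \<phi> \<phi>]
        e(2)[OF that] by simp
  qed simp
  have const: "\<phi> (a + x) = \<phi> a" for a x
  proof -
    have "x \<in> span E" using E by simp
    then show ?thesis
    proof (induction arbitrary: a rule: span_induct_alt)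
      case (step c e y)
      then show ?case using \<open>\<And>a c e. e \<in> E \<Longrightarrow> \<phi> (a + c *\<^sub>R e) = \<phi> a\<close>
        by (metis add.assoc)
    qed simp
  qed
  define f where "f = \<phi> 0"
  have "\<phi> a = f" for a using const[of 0 a] by (simp add: f_def)
  then have f: "induced_on_line F a d f" for a using \<phi>[of a] by simp
  then have line: "F (a + t *\<^sub>R d) = F a + f t *\<^sub>R (F (a + d) - F a)" for a t
    by (simp add: induced_on_line_def)
  have "bij f" "f 1 = 1" using f by (auto simp: induced_on_line_def)
  moreover have "Modules.additive f"
  proof (rule additive_of_translation_rule)
    fix s t
    define D where "D = F d - F 0"
    have "d \<noteq> 0" using d by (simp add: maps_direction_def)
    then have D: "D \<noteq> 0" using F by (simp add: D_def inj_eq)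
    have F0: "F (r *\<^sub>R d) = F 0 + f r *\<^sub>R D" for r using line[of 0 r] by (simp add: D_def)
    have "F ((s + t) *\<^sub>R d) = F (s *\<^sub>R d) + f t *\<^sub>R (F ((s + 1) *\<^sub>R d) - F (s *\<^sub>R d))"
      using line[of "s *\<^sub>R d" t] by (simp add: scaleR_add_left)
    then have "f (s + t) *\<^sub>R D = (f s + f t * (f (s + 1) - f s)) *\<^sub>R D"
      unfolding F0 by (simp add: algebra_simps)
    then show "f (s + t) = f s + f t * (f (s + 1) - f s)" using D by simp
  qed (use \<open>bij f\<close> \<open>f 1 = 1\<close> in \<open>auto simp: bij_is_surj\<close>)
  ultimately show ?thesis using line by blast
qed

section \<open>Injectivity excludes a nondegenerate quadratic term\<close>

text \<open>
  The linear part must be injective, since \<open>k\<close> and \<open>- k\<close> have the same quadratic term; so it is onto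
  and \<open>a = L k\<close> for some \<open>k \<noteq> 0\<close>. Moving from \<open>z\<close> to \<open>z + k\<close> then changes the value by
  \<open>1 + 2 B z k + B k k\<close> times \<open>a\<close>, and nondegeneracy provides a \<open>z\<close> at which this factor vanishes.
\<close>

lemma linear_plus_quadratic_not_inj:
  fixes L :: "'a::euclidean_space \<Rightarrow> 'a" and B :: "'a \<Rightarrow> 'a \<Rightarrow> real"
  assumes "linear L" and B: "bilinear B" and sym: "\<And>x y. B x y = B y x"
    and nondegenerate: "\<And>k. k \<noteq> 0 \<Longrightarrow> \<exists>y. B y k \<noteq> 0"
    and a: "a \<noteq> 0"
  shows "\<not> inj (\<lambda>x. L x + B x x *\<^sub>R a)"
proof
  assume inj: "inj (\<lambda>x. L x + B x x *\<^sub>R a)"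
  interpret L: linear L by fact
  have "inj L"
    unfolding linear_injective_0[OF assms(1)]
  proof (intro allI impI)
    fix k assume "L k = 0"
    then have "L k + B k k *\<^sub>R a = L (- k) + B (- k) (- k) *\<^sub>R a"
      by (simp add: L.neg bilinear_lneg[OF B] bilinear_rneg[OF B])
    then have "k = - k" using injD[OF inj] by blast
    then have "2 *\<^sub>R k = 0" by (metis add.right_inverse scaleR_2)
    then show "k = 0" by simp
  qed
  then have "surj L" using assms(1) linear_injective_imp_surjective by blast
  then obtain k where k: "a = L k" by (metis surjD)
  then have "k \<noteq> 0" using a by auto
  then obtain y where y: "B y k \<noteq> 0" using nondegenerate by blast
  define s where "s = (- 1 - B k k) / (2 * B y k)"
  define z where "z = s *\<^sub>R y"
  have "1 + 2 * B z k + B k k = 0"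
    using y by (simp add: z_def s_def bilinear_lmul[OF B] field_simps)
  then have Bzk: "B (z + k) (z + k) = B z z - 1"
    using sym[of k z] by (simp add: bilinear_ladd[OF B] bilinear_radd[OF B])
  then have "L (z + k) + B (z + k) (z + k) *\<^sub>R a = L z + B z z *\<^sub>R a"
    unfolding Bzk L.add k by (simp add: algebra_simps)
  then have "z + k = z" using injD[OF inj] by blast
  then show False using \<open>k \<noteq> 0\<close> by simp
qed

section \<open>Three directions make the map trilinear\<close>

definition affine_in_each ::
  "'b::real_vector \<Rightarrow> 'b \<Rightarrow> 'b \<Rightarrow> 'b \<Rightarrow> 'b \<Rightarrow> 'b \<Rightarrow> 'b \<Rightarrow> 'b \<Rightarrow> real \<Rightarrow> real \<Rightarrow> real \<Rightarrow> 'b" where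
  "affine_in_each g0 g1 g2 g3 g12 g13 g23 g123 y1 y2 y3 =
     g0 + y1 *\<^sub>R g1 + y2 *\<^sub>R g2 + y3 *\<^sub>R g3 +
     (y1 * y2) *\<^sub>R g12 + (y1 * y3) *\<^sub>R g13 + (y2 * y3) *\<^sub>R g23 + (y1 * y2 * y3) *\<^sub>R g123"

text \<open>
  The coefficients are the iterated differences of \<open>F\<close> over the vertices of the parallelepiped spanned by
  the three vectors: along each edge direction, \<open>F\<close> interpolates affinely between two opposite faces.
\<close>

lemma affine_in_each_exists:
  fixes F :: "'a::real_vector \<Rightarrow> 'b::real_vector"
  assumes 1: "\<And>a t. F (a + t *\<^sub>R e1) = F a + f1 t *\<^sub>R (F (a + e1) - F a)"
    and 2: "\<And>a t. F (a + t *\<^sub>R e2) = F a + f2 t *\<^sub>R (F (a + e2) - F a)"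
    and 3: "\<And>a t. F (a + t *\<^sub>R e3) = F a + f3 t *\<^sub>R (F (a + e3) - F a)"
  shows "\<exists>g0 g1 g2 g3 g12 g13 g23 g123. \<forall>x y z.
    F (x *\<^sub>R e1 + y *\<^sub>R e2 + z *\<^sub>R e3) =
      affine_in_each g0 g1 g2 g3 g12 g13 g23 g123 (f1 x) (f2 y) (f3 z)"
proof -
  have 3: "F (a + z *\<^sub>R e3) = (1 - f3 z) *\<^sub>R F a + f3 z *\<^sub>R F (a + e3)" for a z
    using 3[of a z] by (simp add: algebra_simps)
  have 2: "F (a + y *\<^sub>R e2 + z *\<^sub>R e3) =
      (1 - f2 y) *\<^sub>R F (a + z *\<^sub>R e3) + f2 y *\<^sub>R F (a + e2 + z *\<^sub>R e3)" for a y z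
    using 2[of "a + z *\<^sub>R e3" y] by (simp add: algebra_simps)
  have 1: "F (x *\<^sub>R e1 + y *\<^sub>R e2 + z *\<^sub>R e3) =
      (1 - f1 x) *\<^sub>R F (0 + y *\<^sub>R e2 + z *\<^sub>R e3) + f1 x *\<^sub>R F (e1 + y *\<^sub>R e2 + z *\<^sub>R e3)" for x y z
    using 1[of "y *\<^sub>R e2 + z *\<^sub>R e3" x] by (simp add: algebra_simps)
  have "F (x *\<^sub>R e1 + y *\<^sub>R e2 + z *\<^sub>R e3) = affine_in_each (F 0)
      (F e1 - F 0) (F e2 - F 0) (F e3 - F 0)
      (F (e1 + e2) - F e1 - F e2 + F 0)
      (F (e1 + e3) - F e1 - F e3 + F 0)
      (F (e2 + e3) - F e2 - F e3 + F 0)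
      (F (e1 + e2 + e3) - F (e1 + e2) - F (e1 + e3) - F (e2 + e3) + F e1 + F e2 + F e3 - F 0)
      (f1 x) (f2 y) (f3 z)" for x y z
    unfolding 1 unfolding 2 unfolding 3 affine_in_each_def by (simp add: algebra_simps)
  then show ?thesis by blast
qed

section \<open>Two further directions remove the higher-order terms\<close>

text \<open>
  The direction \<open>(1, 1, 1)\<close> has vanishing second differences; this kills the cubic coefficient and
  gives \<open>g12 + g13 + g23 = 0\<close>, while the second direction gives a second linear relation, with
  coefficients \<open>P Q\<close>, \<open>P R\<close>, \<open>Q R\<close>, where \<open>(P, Q, R)\<close> is the transformed direction. Its entries
  cannot all be equal, so if the quadratic part is not zero, then the two relations leave a
  one-dimensional space of solutions: all three coefficients are multiples of one vector, and the
  quadratic part is a scalar quadratic form times that vector. It is the form of the conic through the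
  five transformed directions. The conic is smooth, hence the form is nondegenerate, which injectivity
  forbids.

  A direction is moved by three different functions \<open>f1\<close>, \<open>f2\<close>, \<open>f3\<close>, so distinctness of \<open>p\<close>, \<open>q\<close>, \<open>r\<close>
  does not directly give that of \<open>P\<close>, \<open>Q\<close>, \<open>R\<close>. Smoothness is recovered from the relations \<open>rel\<close>
  between the functions: if one quadratic coefficient vanishes, two of the functions coincide, and then
  injectivity separates the corresponding two of \<open>P\<close>, \<open>Q\<close>, \<open>R\<close>.
\<close>

lemma two_diagonal_directions_force_affine:
  fixes g0 g1 g2 g3 g12 g13 g23 g123 :: "real^3" and f1 f2 f3 f4 :: "real \<Rightarrow> real"
  defines "G \<equiv> affine_in_each g0 g1 g2 g3 g12 g13 g23 g123"
  assumes inj: "\<And>x y z x' y' z'. G x y z = G x' y' z' \<Longrightarrow> x = x' \<and> y = y' \<and> z = z'"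
    and f: "Modules.additive f1" "Modules.additive f2" "Modules.additive f3" "Modules.additive f4" "surj f4"
      "inj f1" "inj f2" "inj f3" "f1 1 = 1" "f2 1 = 1" "f3 1 = 1" "f4 1 = 1"
    and diag1: "\<And>x y z t. G (x + f1 t) (y + f2 t) (z + f3 t) =
        G x y z + f4 t *\<^sub>R (G (x + 1) (y + 1) (z + 1) - G x y z)"
    and diag2: "\<And>x y z. G (x + f1 p) (y + f2 q) (z + f3 r) + G (x - f1 p) (y - f2 q) (z - f3 r) =
        2 *\<^sub>R G x y z"
    and pqr: "p \<noteq> 0" "q \<noteq> 0" "r \<noteq> 0" "p \<noteq> q" "p \<noteq> r" "q \<noteq> r"
  shows "g12 = 0 \<and> g13 = 0 \<and> g23 = 0 \<and> g123 = 0"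
proof -
  define P Q R where PQR: "P = f1 p" "Q = f2 q" "R = f3 r"
  have z: "f1 0 = 0" "f2 0 = 0" "f3 0 = 0" using f additive.zero by auto
  have m1: "f1 (-1) = -1" "f2 (-1) = -1" "f3 (-1) = -1" "f4 (-1) = -1" using f additive.minus by metis+
  have PQR0: "P \<noteq> 0" "Q \<noteq> 0" "R \<noteq> 0"
    using pqr z f(6-8) unfolding PQR by (metis injD)+
  note G = G_def affine_in_each_def
  \<comment> \<open>the second difference of \<open>G\<close> along \<open>(1, 1, 1)\<close>, from the condition at \<open>t = -1\<close>\<close>
  have second: "2 *\<^sub>R (g12 + g13 + g23 + (x + y + z) *\<^sub>R g123) = 0" for x y z
  proof -
    have "G (x - 1) (y - 1) (z - 1) + G (x + 1) (y + 1) (z + 1) = 2 *\<^sub>R G x y z"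
      using diag1[of x "-1" y z] m1 by (simp add: algebra_simps scaleR_2)
    moreover have "G (x - 1) (y - 1) (z - 1) + G (x + 1) (y + 1) (z + 1) =
        2 *\<^sub>R G x y z + 2 *\<^sub>R (g12 + g13 + g23 + (x + y + z) *\<^sub>R g123)"
      unfolding G by (simp add: vec_eq_iff algebra_simps)
    ultimately show ?thesis by simp
  qed
  have g123: "g123 = 0" using second[of 0 0 0] second[of 1 0 0] by simp
  have sum0: "g12 + g13 + g23 = 0" using second[of 0 0 0] by simp
  note G' = G g123
  have "2 *\<^sub>R ((P * Q) *\<^sub>R g12 + (P * R) *\<^sub>R g13 + (Q * R) *\<^sub>R g23) = 0"
    using diag2[of 0 0 0] unfolding PQR[symmetric] G' by (simp add: vec_eq_iff algebra_simps)
  then have sumPQR: "(P * Q) *\<^sub>R g12 + (P * R) *\<^sub>R g13 + (Q * R) *\<^sub>R g23 = 0" by simp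
  \<comment> \<open>Subtracting the condition at the origin from the one at a unit vector isolates the quadratic terms.\<close>
  have defect: "G (x + f1 t) (y + f2 t) (z + f3 t) - G x y z -
      f4 t *\<^sub>R (G (x + 1) (y + 1) (z + 1) - G x y z) = 0" for x y z t
    using diag1[of x t y z] by simp
  have rel: "f2 t *\<^sub>R g12 + f3 t *\<^sub>R g13 = f4 t *\<^sub>R (g12 + g13)"
    "f1 t *\<^sub>R g12 + f3 t *\<^sub>R g23 = f4 t *\<^sub>R (g12 + g23)"
    "f1 t *\<^sub>R g13 + f2 t *\<^sub>R g23 = f4 t *\<^sub>R (g13 + g23)" for t
  proof -
    have "f2 t *\<^sub>R g12 + f3 t *\<^sub>R g13 - f4 t *\<^sub>R (g12 + g13) = 0"
      using arg_cong2[where f = "(-)", OF defect[of 1 t 0 0] defect[of 0 t 0 0]]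
      unfolding G' by (simp add: vec_eq_iff algebra_simps)
    then show "f2 t *\<^sub>R g12 + f3 t *\<^sub>R g13 = f4 t *\<^sub>R (g12 + g13)" by simp
    have "f1 t *\<^sub>R g12 + f3 t *\<^sub>R g23 - f4 t *\<^sub>R (g12 + g23) = 0"
      using arg_cong2[where f = "(-)", OF defect[of 0 t 1 0] defect[of 0 t 0 0]]
      unfolding G' by (simp add: vec_eq_iff algebra_simps)
    then show "f1 t *\<^sub>R g12 + f3 t *\<^sub>R g23 = f4 t *\<^sub>R (g12 + g23)" by simp
    have "f1 t *\<^sub>R g13 + f2 t *\<^sub>R g23 - f4 t *\<^sub>R (g13 + g23) = 0"
      using arg_cong2[where f = "(-)", OF defect[of 0 t 0 1] defect[of 0 t 0 0]]
      unfolding G' by (simp add: vec_eq_iff algebra_simps)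
    then show "f1 t *\<^sub>R g13 + f2 t *\<^sub>R g23 = f4 t *\<^sub>R (g13 + g23)" by simp
  qed
  have split12: "f1 t = f2 t" if "g12 = 0" "g13 \<noteq> 0" for t
  proof -
    have "g23 = - g13" using sum0 that by (simp add: add_eq_0_iff)
    then have "(f1 t - f2 t) *\<^sub>R g13 = 0" using rel(3)[of t] by (simp add: algebra_simps)
    then show ?thesis using that by simp
  qed
  have split13: "f1 t = f3 t" if "g13 = 0" "g12 \<noteq> 0" for t
  proof -
    have "g23 = - g12" using sum0 that by (simp add: add_eq_0_iff)
    then have "(f1 t - f3 t) *\<^sub>R g12 = 0" using rel(2)[of t] by (simp add: algebra_simps)
    then show ?thesis using that by simp
  qed
  have split23: "f2 t = f3 t" if "g23 = 0" "g12 \<noteq> 0" for t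
  proof -
    have "g13 = - g12" using sum0 that by (simp add: add_eq_0_iff)
    then have "(f2 t - f3 t) *\<^sub>R g12 = 0" using rel(1)[of t] by (simp add: algebra_simps)
    then show ?thesis using that by simp
  qed
  have "g12 = 0 \<and> g13 = 0 \<and> g23 = 0"
  proof (rule ccontr)
    assume nz: "\<not> ?thesis"
    have g23: "g23 = - g12 - g13" using sum0 by (simp add: algebra_simps eq_neg_iff_add_eq_0)
    have dep: "(Q * (P - R)) *\<^sub>R g12 = (R * (Q - P)) *\<^sub>R g13"
      using sumPQR unfolding g23 by (simp add: algebra_simps)
    have n12: "g12 \<noteq> 0"
    proof
      assume 0: "g12 = 0"
      then have 1: "g13 \<noteq> 0" using nz g23 by auto
      then have "P \<noteq> Q" using split12[OF 0 1, of q] inj_eq[OF f(6)] pqr unfolding PQR by metis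
      then show False using dep 0 1 PQR0 by simp
    qed
    have n13: "g13 \<noteq> 0"
    proof
      assume 0: "g13 = 0"
      then have "P \<noteq> R" using split13[OF 0 n12, of r] inj_eq[OF f(6)] pqr unfolding PQR by metis
      then show False using dep 0 n12 PQR0 by simp
    qed
    have n23: "g23 \<noteq> 0"
    proof
      assume 0: "g23 = 0"
      then have 1: "g13 = - g12" using g23 by (simp add: algebra_simps eq_neg_iff_add_eq_0)
      have "Q \<noteq> R" using split23[OF 0 n12, of r] inj_eq[OF f(7)] pqr unfolding PQR by metis
      moreover have "(P * (Q - R)) *\<^sub>R g12 = 0" using dep unfolding 1 by (simp add: algebra_simps)
      ultimately show False using n12 PQR0 by simp
    qed
    \<comment> \<open>If \<open>P = Q\<close>, then \<open>P = Q = R\<close>, and \<open>G P P P\<close> lies on the image of the diagonal line, which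
      injectivity reserves for the points of that line.\<close>
    have "P \<noteq> Q"
    proof
      assume PQ: "P = Q"
      then have PR: "P = R" using dep n12 PQR0 by simp
      obtain \<tau> where \<tau>: "f4 \<tau> = P" using f(5) by (metis surjD)
      have "G (f1 \<tau>) (f2 \<tau>) (f3 \<tau>) = G 0 0 0 + P *\<^sub>R (G 1 1 1 - G 0 0 0)"
        using diag1[of 0 \<tau> 0 0] by (simp add: \<tau>)
      also have "\<dots> = G P P P"
      proof -
        have "G P P P = G 0 0 0 + P *\<^sub>R (G 1 1 1 - G 0 0 0) + (P * P - P) *\<^sub>R (g12 + g13 + g23)"
          unfolding G' by (simp add: algebra_simps)
        then show ?thesis using sum0 by simp
      qed
      finally have "f1 \<tau> = P \<and> f2 \<tau> = P" using inj by blast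
      then have "\<tau> = p" "\<tau> = q" using PQ f(6,7) unfolding PQR by (metis injD)+
      then show False using pqr by simp
    qed
    define \<kappa> where "\<kappa> = Q * (P - R) / (R * (Q - P))"
    have g13: "g13 = \<kappa> *\<^sub>R g12"
    proof -
      have "(R * (Q - P)) *\<^sub>R g13 = (R * (Q - P)) *\<^sub>R \<kappa> *\<^sub>R g12"
        using dep PQR0 \<open>P \<noteq> Q\<close> by (simp add: \<kappa>_def)
      moreover have "R * (Q - P) \<noteq> 0" using PQR0 \<open>P \<noteq> Q\<close> by simp
      ultimately show ?thesis using scaleR_left_imp_eq by blast
    qed
    have g23': "g23 = - (1 + \<kappa>) *\<^sub>R g12" unfolding g23 g13 by (simp add: algebra_simps)
    have \<kappa>: "\<kappa> \<noteq> 0" "1 + \<kappa> \<noteq> 0" using n13 n23 unfolding g13 g23' by auto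
    define L where "L y = y$1 *\<^sub>R g1 + y$2 *\<^sub>R g2 + y$3 *\<^sub>R g3" for y :: "real^3"
    \<comment> \<open>the polarization of \<open>y1 y2 + \<kappa> y1 y3 - (1 + \<kappa>) y2 y3\<close>\<close>
    define B where "B x y = (x$1 * y$2 + x$2 * y$1) / 2 + \<kappa> * (x$1 * y$3 + x$3 * y$1) / 2
      - (1 + \<kappa>) * (x$2 * y$3 + x$3 * y$2) / 2" for x y :: "real^3"
    have "\<not> inj (\<lambda>y. L y + B y y *\<^sub>R g12)"
    proof (rule linear_plus_quadratic_not_inj[where L = L and B = B and a = g12])
      show "linear L" by (rule linearI) (simp_all add: L_def algebra_simps)
      show "bilinear B" unfolding bilinear_def
        by (intro conjI allI linearI) (simp_all add: B_def field_simps)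
      show "B x y = B y x" for x y by (simp add: B_def algebra_simps)
      show "\<exists>y. B y k \<noteq> 0" if "k \<noteq> 0" for k
      proof (rule ccontr)
        assume "\<not> ?thesis"
        then have 0: "B (axis i 1) k = 0" for i by blast
        have 1: "k$2 + \<kappa> * k$3 = 0" using 0[of 1] by (simp add: B_def axis_def)
        have 2: "k$1 = (1 + \<kappa>) * k$3" using 0[of 2] by (simp add: B_def axis_def)
        have 3: "\<kappa> * k$1 = (1 + \<kappa>) * k$2" using 0[of 3] by (simp add: B_def axis_def)
        have "2 * (\<kappa> * (1 + \<kappa>)) * k$3 = 0" using 1 2 3 by algebra
        then have "k$3 = 0" using \<kappa> by simp
        then have "k = 0" using 1 2 by (simp add: vec_eq_iff forall_3)
        then show False using that by simp
      qed
      show "g12 \<noteq> 0" by fact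
    qed
    moreover have "inj (\<lambda>y. L y + B y y *\<^sub>R g12)"
    proof (rule injI)
      fix x y assume eq: "L x + B x x *\<^sub>R g12 = L y + B y y *\<^sub>R g12"
      have B: "B y y = y$1 * y$2 + \<kappa> * (y$1 * y$3) - (1 + \<kappa>) * (y$2 * y$3)" for y
        by (simp add: B_def field_simps)
      have "G (y$1) (y$2) (y$3) = g0 + (L y + B y y *\<^sub>R g12)" for y
        unfolding G' g13 g23' L_def B by (simp add: vec_eq_iff algebra_simps)
      then have "G (x$1) (x$2) (x$3) = G (y$1) (y$2) (y$3)" using eq by simp
      from inj[OF this] show "x = y" by (simp add: vec_eq_iff forall_3)
    qed
    ultimately show False by blast
  qed
  then show ?thesis using g123 by blast
qed

section \<open>Coordinates adapted to five directions\<close>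

lemma j_independent_3D:
  assumes "j_independent 3 v" "i \<noteq> j" "i \<noteq> k" "j \<noteq> k"
    and "\<alpha> *\<^sub>R v i + \<beta> *\<^sub>R v j + \<gamma> *\<^sub>R v k = 0"
  shows "\<alpha> = 0 \<and> \<beta> = 0 \<and> \<gamma> = 0"
proof -
  have "card {i, j, k} = 3" using assms(2-4) by simp
  then have inj: "inj_on v {i, j, k}" and ind: "independent (v ` {i, j, k})"
    using assms(1) unfolding j_independent_def independent_family_on_def by blast+
  have ne: "v i \<noteq> v j" "v i \<noteq> v k" "v j \<noteq> v k"
    using inj assms(2-4) by (auto simp: inj_on_def)
  define u where "u x = (if x = v i then \<alpha> else if x = v j then \<beta> else \<gamma>)" for x
  have "(\<Sum>x\<in>v ` {i, j, k}. u x *\<^sub>R x) = \<alpha> *\<^sub>R v i + \<beta> *\<^sub>R v j + \<gamma> *\<^sub>R v k"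
    using ne by (simp add: u_def add.assoc)
  then have *: "u x = 0" if "x \<in> v ` {i, j, k}" for x
    using independentD[OF ind _ order_refl, of u] that assms(5) by simp
  show ?thesis using *[of "v i"] *[of "v j"] *[of "v k"] ne by (auto simp: u_def)
qed

lemma basis_family_real3:
  fixes w :: "3 \<Rightarrow> real^3"
  assumes "\<And>\<alpha> \<beta> \<gamma>. \<alpha> *\<^sub>R w 1 + \<beta> *\<^sub>R w 2 + \<gamma> *\<^sub>R w 3 = 0 \<Longrightarrow> \<alpha> = 0 \<and> \<beta> = 0 \<and> \<gamma> = 0"
  shows "basis_family w"
proof -
  define L where "L y = (\<Sum>i\<in>UNIV. y$i *\<^sub>R w i)" for y :: "real^3"
  have lin: "linear L"
    by (rule linearI) (simp_all add: L_def sum_3 algebra_simps)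
  have injL: "inj L"
    unfolding linear_injective_0[OF lin]
  proof (intro allI impI)
    fix y assume "L y = 0"
    then have "y$1 = 0 \<and> y$2 = 0 \<and> y$3 = 0" by (intro assms) (simp add: L_def sum_3)
    then show "y = 0" by (simp add: vec_eq_iff forall_3)
  qed
  have w: "w i = L (axis i 1)" for i
    using exhaust_3[of i] by (auto simp: L_def sum_3 axis_def)
  have Basis: "range w = L ` Basis"
  proof -
    have Basis: "(Basis :: (real^3) set) = range (\<lambda>i. axis i 1)" by (auto simp: Basis_vec_def)
    show ?thesis unfolding Basis image_image by (rule image_cong) (simp_all add: w)
  qed
  have "inj w"
  proof (rule injI)
    fix i j assume "w i = w j"
    then have "axis i 1 = (axis j 1 :: real^3)" unfolding w by (rule injD[OF injL])
    then show "i = j" by (simp add: axis_eq_axis)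
  qed
  moreover have "independent (range w)"
    unfolding Basis using linear_independent_injective_image[OF lin independent_Basis] injL
    by (simp add: inj_on_subset)
  moreover have "span (range w) = UNIV"
    unfolding Basis using linear_span_image[OF lin, of Basis] linear_injective_imp_surjective[OF lin injL]
    by simp
  ultimately show ?thesis by (simp add: basis_family_def independent_family_on_def)
qed

lemma span_eq_UNIV_if_independent:
  fixes x y z :: "real^3"
  assumes "\<And>\<alpha> \<beta> \<gamma>. \<alpha> *\<^sub>R x + \<beta> *\<^sub>R y + \<gamma> *\<^sub>R z = 0 \<Longrightarrow> \<alpha> = 0 \<and> \<beta> = 0 \<and> \<gamma> = 0"
  shows "span {x, y, z} = UNIV"
proof -
  define w :: "3 \<Rightarrow> real^3" where "w i = (if i = 1 then x else if i = 2 then y else z)" for i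
  have w: "w 1 = x" "w 2 = y" "w 3 = z" by (simp_all add: w_def)
  have "basis_family w"
    by (rule basis_family_real3, unfold w, rule assms)
  moreover have "range w = {x, y, z}"
    unfolding UNIV_3 image_insert image_empty w ..
  ultimately show ?thesis by (simp add: basis_family_def)
qed

lemma basis_family_expansion:
  fixes u :: "'i::finite \<Rightarrow> 'a::real_vector"
  assumes "basis_family u"
  shows "\<exists>\<alpha>. x = (\<Sum>i\<in>UNIV. \<alpha> i *\<^sub>R u i)"
proof -
  have "x \<in> span (range u)" "inj u"
    using assms by (simp_all add: basis_family_def independent_family_on_def)
  then obtain h where "x = (\<Sum>b\<in>range u. h b *\<^sub>R b)" by (auto simp: span_finite)
  then have "x = (\<Sum>i\<in>UNIV. h (u i) *\<^sub>R u i)" using \<open>inj u\<close> by (simp add: sum.reindex)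
  then show ?thesis by (rule exI[of _ "\<lambda>i. h (u i)"])
qed

text \<open>
  Rescaling three of the vectors makes a fourth one their sum. A vanishing coordinate of the fifth vector,
  or two equal ones, would put it in a plane with two of the other four.
\<close>

lemma five_directions_coordinates:
  fixes v :: "5 \<Rightarrow> real^3"
  assumes "j_independent 3 v"
  obtains c1 c2 c3 p q r where "c1 \<noteq> 0" "c2 \<noteq> 0" "c3 \<noteq> 0"
    "v 3 = c1 *\<^sub>R v 0 + c2 *\<^sub>R v 1 + c3 *\<^sub>R v 2"
    "v 4 = p *\<^sub>R c1 *\<^sub>R v 0 + q *\<^sub>R c2 *\<^sub>R v 1 + r *\<^sub>R c3 *\<^sub>R v 2"
    "p \<noteq> 0" "q \<noteq> 0" "r \<noteq> 0" "p \<noteq> q" "p \<noteq> r" "q \<noteq> r"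
proof -
  note ind = j_independent_3D[OF assms]
  define w :: "3 \<Rightarrow> real^3" where "w i = (if i = 1 then v 0 else if i = 2 then v 1 else v 2)" for i
  have w: "w 1 = v 0" "w 2 = v 1" "w 3 = v 2" by (simp_all add: w_def)
  have "basis_family w"
    by (rule basis_family_real3, unfold w, rule ind[of 0 1 2]) simp_all
  then have expand: "\<exists>\<alpha> \<beta> \<gamma>. x = \<alpha> *\<^sub>R v 0 + \<beta> *\<^sub>R v 1 + \<gamma> *\<^sub>R v 2" for x
    using basis_family_expansion[of w x] unfolding sum_3 w by blast
  obtain c1 c2 c3 where c: "v 3 = c1 *\<^sub>R v 0 + c2 *\<^sub>R v 1 + c3 *\<^sub>R v 2"
    using expand by blast
  obtain d1 d2 d3 where d: "v 4 = d1 *\<^sub>R v 0 + d2 *\<^sub>R v 1 + d3 *\<^sub>R v 2"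
    using expand by blast
  have c0: "c1 \<noteq> 0" "c2 \<noteq> 0" "c3 \<noteq> 0"
  proof -
    show "c1 \<noteq> 0" using ind[of 3 1 2 "-1" c2 c3] c by force
    show "c2 \<noteq> 0" using ind[of 3 0 2 "-1" c1 c3] c by force
    show "c3 \<noteq> 0" using ind[of 3 0 1 "-1" c1 c2] c by force
  qed
  have d0: "d1 \<noteq> 0" "d2 \<noteq> 0" "d3 \<noteq> 0"
  proof -
    show "d1 \<noteq> 0" using ind[of 4 1 2 "-1" d2 d3] d by force
    show "d2 \<noteq> 0" using ind[of 4 0 2 "-1" d1 d3] d by force
    show "d3 \<noteq> 0" using ind[of 4 0 1 "-1" d1 d2] d by force
  qed
  define p q r where pqr: "p = d1 / c1" "q = d2 / c2" "r = d3 / c3"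
  have dpqr: "d1 = p * c1" "d2 = q * c2" "d3 = r * c3" using c0 by (simp_all add: pqr)
  have "p \<noteq> q"
  proof
    assume "p = q"
    then have "1 *\<^sub>R v 4 + (- p) *\<^sub>R v 3 + ((p - r) * c3) *\<^sub>R v 2 = 0"
      unfolding c d dpqr by (simp add: algebra_simps)
    from ind[OF _ _ _ this] show False by simp
  qed
  moreover have "p \<noteq> r"
  proof
    assume "p = r"
    then have "1 *\<^sub>R v 4 + (- p) *\<^sub>R v 3 + ((p - q) * c2) *\<^sub>R v 1 = 0"
      unfolding c d dpqr by (simp add: algebra_simps)
    from ind[OF _ _ _ this] show False by simp
  qed
  moreover have "q \<noteq> r"
  proof
    assume "q = r"
    then have "1 *\<^sub>R v 4 + (- q) *\<^sub>R v 3 + ((q - p) * c1) *\<^sub>R v 0 = 0"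
      unfolding c d dpqr by (simp add: algebra_simps)
    from ind[OF _ _ _ this] show False by simp
  qed
  ultimately show ?thesis using that[OF c0 c, of p q r] d d0 c0 by (simp add: dpqr)
qed

section \<open>Maps preserving lines in five directions\<close>

theorem theorem1p6:
  fixes v :: "5 \<Rightarrow> real^3" and F :: "real^3 \<Rightarrow> real^3"
  assumes "j_independent 3 v"
    and "inj F"
    and "\<forall>l \<in> lines_parallel v. is_line (F ` l)"
  shows "affine_additive F \<and>
    (\<exists>(u :: 3 \<Rightarrow> real^3) (w :: 3 \<Rightarrow> real^3) (f :: 3 \<Rightarrow> real \<Rightarrow> real).
       basis_family u \<and> basis_family w \<and>
       (\<forall>i. Modules.additive (f i) \<and> bij (f i) \<and> f i 1 = 1) \<and>
       (\<forall>\<alpha> :: 3 \<Rightarrow> real.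
          F (\<Sum>i\<in>UNIV. \<alpha> i *\<^sub>R u i) - F 0 = (\<Sum>i\<in>UNIV. f i (\<alpha> i) *\<^sub>R w i)))"
proof -
  note ind = j_independent_3D[OF assms(1)]
  obtain c1 c2 c3 p q r where c: "c1 \<noteq> 0" "c2 \<noteq> 0" "c3 \<noteq> 0"
    and v3: "v 3 = c1 *\<^sub>R v 0 + c2 *\<^sub>R v 1 + c3 *\<^sub>R v 2"
    and v4: "v 4 = p *\<^sub>R c1 *\<^sub>R v 0 + q *\<^sub>R c2 *\<^sub>R v 1 + r *\<^sub>R c3 *\<^sub>R v 2"
    and pqr: "p \<noteq> 0" "q \<noteq> 0" "r \<noteq> 0" "p \<noteq> q" "p \<noteq> r" "q \<noteq> r"
    using five_directions_coordinates[OF assms(1)] by metis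
  have v: "maps_direction F (v i)" for i
  proof -
    obtain j k where jk: "i \<noteq> j" "i \<noteq> k" "j \<noteq> k"
    proof -
      consider "i = 0" | "i = 1" | "i \<noteq> 0" "i \<noteq> 1" by blast
      then show ?thesis by cases (use that[of 1 2] that[of 0 2] that[of 0 1] in simp_all)
    qed
    have "v i \<noteq> 0" using ind[OF jk, of 1 0 0] by auto
    moreover from this have "line a (v i) \<in> lines_parallel v" for a
      unfolding lines_parallel_def parallel_to_def by blast
    ultimately show ?thesis using assms(3) by (simp add: maps_direction_def)
  qed
  have indep_dir: "\<exists>f. Modules.additive f \<and> bij f \<and> f 1 = 1 \<and>
      (\<forall>a t. F (a + t *\<^sub>R d) = F a + f t *\<^sub>R (F (a + d) - F a))"
    if "d = c *\<^sub>R v i" "c \<noteq> 0" "j \<noteq> k" "j \<noteq> l" "k \<noteq> l" "i \<noteq> j" "i \<noteq> k" "i \<noteq> l" for d c i j k l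
  proof (rule induced_uniformly[where E = "{v j, v k, v l}"])
    show "maps_direction F d" using that v maps_direction_scale by blast
    show "maps_direction F e" if "e \<in> {v j, v k, v l}" for e using that v by blast
    show "d \<noteq> s *\<^sub>R e" if "e \<in> {v j, v k, v l}" for e s
      using that ind[of i j k c "-s" 0] ind[of i k j c "-s" 0] ind[of i l k c "-s" 0]
        \<open>d = c *\<^sub>R v i\<close> \<open>c \<noteq> 0\<close> \<open>j \<noteq> k\<close> \<open>j \<noteq> l\<close> \<open>k \<noteq> l\<close> \<open>i \<noteq> j\<close> \<open>i \<noteq> k\<close> \<open>i \<noteq> l\<close> by auto
    show "span {v j, v k, v l} = UNIV"
      by (rule span_eq_UNIV_if_independent) (use ind that in blast)
  qed (fact assms)
  define e1 e2 e3 where e: "e1 = c1 *\<^sub>R v 0" "e2 = c2 *\<^sub>R v 1" "e3 = c3 *\<^sub>R v 2"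
  obtain f1 where f1: "Modules.additive f1" "bij f1" "f1 1 = 1"
    "\<And>a t. F (a + t *\<^sub>R e1) = F a + f1 t *\<^sub>R (F (a + e1) - F a)"
    using indep_dir[OF e(1) c(1), of 1 2 3] by auto
  obtain f2 where f2: "Modules.additive f2" "bij f2" "f2 1 = 1"
    "\<And>a t. F (a + t *\<^sub>R e2) = F a + f2 t *\<^sub>R (F (a + e2) - F a)"
    using indep_dir[OF e(2) c(2), of 0 2 3] by auto
  obtain f3 where f3: "Modules.additive f3" "bij f3" "f3 1 = 1"
    "\<And>a t. F (a + t *\<^sub>R e3) = F a + f3 t *\<^sub>R (F (a + e3) - F a)"
    using indep_dir[OF e(3) c(3), of 0 1 3] by auto
  obtain f4 where f4: "Modules.additive f4" "bij f4" "f4 1 = 1"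
    "\<And>a t. F (a + t *\<^sub>R v 3) = F a + f4 t *\<^sub>R (F (a + v 3) - F a)"
    using indep_dir[of "v 3" 1 3 0 1 2] by auto
  obtain f5 where f5: "Modules.additive f5" "bij f5" "f5 1 = 1"
    "\<And>a t. F (a + t *\<^sub>R v 4) = F a + f5 t *\<^sub>R (F (a + v 4) - F a)"
    using indep_dir[of "v 4" 1 4 0 1 2] by auto
  obtain g0 g1 g2 g3 g12 g13 g23 g123 where g: "\<And>x y z.
    F (x *\<^sub>R e1 + y *\<^sub>R e2 + z *\<^sub>R e3) =
      affine_in_each g0 g1 g2 g3 g12 g13 g23 g123 (f1 x) (f2 y) (f3 z)"
    using affine_in_each_exists[of F e1 f1 e2 f2 e3 f3, OF f1(4) f2(4) f3(4)] by metis
  define G where "G = affine_in_each g0 g1 g2 g3 g12 g13 g23 g123"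
  have FG: "F (x *\<^sub>R e1 + y *\<^sub>R e2 + z *\<^sub>R e3) = G (f1 x) (f2 y) (f3 z)" for x y z
    using g by (simp add: G_def)
  have e_ind: "\<alpha> = 0 \<and> \<beta> = 0 \<and> \<gamma> = 0" if "\<alpha> *\<^sub>R e1 + \<beta> *\<^sub>R e2 + \<gamma> *\<^sub>R e3 = 0" for \<alpha> \<beta> \<gamma>
    using ind[of 0 1 2 "\<alpha> * c1" "\<beta> * c2" "\<gamma> * c3"] that c by (simp add: e)
  have injG: "x = x' \<and> y = y' \<and> z = z'" if "G x y z = G x' y' z'" for x y z x' y' z'
  proof -
    obtain s1 s2 s3 s1' s2' s3' where s: "x = f1 s1" "y = f2 s2" "z = f3 s3"
      "x' = f1 s1'" "y' = f2 s2'" "z' = f3 s3'"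
      using f1(2) f2(2) f3(2) by (metis bij_pointE)
    have "s1 *\<^sub>R e1 + s2 *\<^sub>R e2 + s3 *\<^sub>R e3 = s1' *\<^sub>R e1 + s2' *\<^sub>R e2 + s3' *\<^sub>R e3"
      using that injD[OF assms(2)] unfolding s FG[symmetric] by blast
    then have "(s1 - s1') *\<^sub>R e1 + (s2 - s2') *\<^sub>R e2 + (s3 - s3') *\<^sub>R e3 = 0"
      by (simp add: algebra_simps)
    from e_ind[OF this] show ?thesis by (simp add: s)
  qed
  \<comment> \<open>Additivity of the \<open>f\<^sub>i\<close> carries translations of the domain over to the coordinates of \<open>G\<close>.\<close>
  have shift: "G (x + f1 a) (y + f2 b) (z + f3 c) =
      F (s1 *\<^sub>R e1 + s2 *\<^sub>R e2 + s3 *\<^sub>R e3 + (a *\<^sub>R e1 + b *\<^sub>R e2 + c *\<^sub>R e3))"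
    if "x = f1 s1" "y = f2 s2" "z = f3 s3" for x y z s1 s2 s3 a b c
  proof -
    have "G (x + f1 a) (y + f2 b) (z + f3 c) = G (f1 (s1 + a)) (f2 (s2 + b)) (f3 (s3 + c))"
      using that f1(1) f2(1) f3(1) by (simp add: additive.add)
    then show ?thesis by (simp add: FG[symmetric] algebra_simps)
  qed
  have v3': "v 3 = e1 + e2 + e3" and v4': "v 4 = p *\<^sub>R e1 + q *\<^sub>R e2 + r *\<^sub>R e3"
    using v3 v4 by (simp_all add: e)
  have z: "g12 = 0 \<and> g13 = 0 \<and> g23 = 0 \<and> g123 = 0"
  proof (rule two_diagonal_directions_force_affine[where ?g0.0 = g0 and ?g1.0 = g1 and ?g2.0 = g2
        and ?g3.0 = g3 and ?g12.0 = g12 and ?g13.0 = g13 and ?g23.0 = g23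
        and ?g123.0 = g123 and ?f1.0 = f1 and ?f2.0 = f2 and ?f3.0 = f3 and ?f4.0 = f4
        and p = p and q = q and r = r, folded G_def])
    show "x = x' \<and> y = y' \<and> z = z'" if "G x y z = G x' y' z'" for x y z x' y' z'
      using that by (rule injG)
    fix x y z t
    obtain s1 s2 s3 where s: "x = f1 s1" "y = f2 s2" "z = f3 s3"
      using f1(2) f2(2) f3(2) by (metis bij_pointE)
    define a where "a = s1 *\<^sub>R e1 + s2 *\<^sub>R e2 + s3 *\<^sub>R e3"
    note sh = shift[OF s, folded a_def]
    have G0: "G x y z = F a" using FG s by (simp add: a_def)
    show "G (x + f1 t) (y + f2 t) (z + f3 t) =
        G x y z + f4 t *\<^sub>R (G (x + 1) (y + 1) (z + 1) - G x y z)"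
      using f4(4)[of a t] sh[of t t t] sh[of 1 1 1] unfolding f1(3) f2(3) f3(3)
      by (simp add: G0 v3' scaleR_add_right)
    have "G (x - f1 p) (y - f2 q) (z - f3 r) = F (a + (-1) *\<^sub>R v 4)"
      using sh[of "-p" "-q" "-r"] f1(1) f2(1) f3(1) by (simp add: additive.minus v4' algebra_simps)
    also have "\<dots> = 2 *\<^sub>R F a - F (a + v 4)"
      using f5(4)[of a "-1"] f5(1,3) by (simp add: additive.minus scaleR_2)
    finally show "G (x + f1 p) (y + f2 q) (z + f3 r) + G (x - f1 p) (y - f2 q) (z - f3 r) =
        2 *\<^sub>R G x y z"
      using sh[of p q r] by (simp add: G0 v4')
  qed (use f1(1-3) f2(1-3) f3(1-3) f4(1-3) pqr in \<open>auto simp: bij_is_inj bij_is_surj\<close>)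
  have zero: "f1 0 = 0" "f2 0 = 0" "f3 0 = 0"
    using f1(1) f2(1) f3(1) by (simp_all add: additive.zero)
  have F: "F (x *\<^sub>R e1 + y *\<^sub>R e2 + z *\<^sub>R e3) - F 0 = f1 x *\<^sub>R g1 + f2 y *\<^sub>R g2 + f3 z *\<^sub>R g3" for x y z
    using FG[of x y z] FG[of 0 0 0] z by (simp add: G_def affine_in_each_def zero)
  define u where "u i = (if i = 1 then e1 else if i = 2 then e2 else e3)" for i :: 3
  define w where "w i = (if i = 1 then g1 else if i = 2 then g2 else g3)" for i :: 3
  define f where "f i = (if i = 1 then f1 else if i = 2 then f2 else f3)" for i :: 3
  have uwf: "u 1 = e1" "u 2 = e2" "u 3 = e3" "w 1 = g1" "w 2 = g2" "w 3 = g3"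
    "f 1 = f1" "f 2 = f2" "f 3 = f3" by (simp_all add: u_def w_def f_def)
  have u: "basis_family u"
    by (rule basis_family_real3, rule e_ind) (simp only: uwf)
  have w: "basis_family w"
  proof (rule basis_family_real3)
    fix \<alpha> \<beta> \<gamma> assume "\<alpha> *\<^sub>R w 1 + \<beta> *\<^sub>R w 2 + \<gamma> *\<^sub>R w 3 = 0"
    then have "G \<alpha> \<beta> \<gamma> = G 0 0 0" using z by (simp add: uwf G_def affine_in_each_def add.assoc)
    then show "\<alpha> = 0 \<and> \<beta> = 0 \<and> \<gamma> = 0" by (rule injG)
  qed
  have f: "\<forall>i. Modules.additive (f i) \<and> bij (f i) \<and> f i 1 = 1"
    using f1(1-3) f2(1-3) f3(1-3) by (simp add: f_def)
  have rep: "F (\<Sum>i\<in>UNIV. \<alpha> i *\<^sub>R u i) - F 0 = (\<Sum>i\<in>UNIV. f i (\<alpha> i) *\<^sub>R w i)" for \<alpha>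
    using F[of "\<alpha> 1" "\<alpha> 2" "\<alpha> 3"] by (simp add: sum_3 uwf)
  note coords = basis_family_expansion[OF u]
  have "affine_additive F"
    unfolding affine_additive_def
  proof (rule Modules.additive.intro)
    fix x y
    obtain \<alpha> \<beta> where x: "x = (\<Sum>i\<in>UNIV. \<alpha> i *\<^sub>R u i)" and y: "y = (\<Sum>i\<in>UNIV. \<beta> i *\<^sub>R u i)"
      using coords by metis
    have "x + y = (\<Sum>i\<in>UNIV. (\<alpha> i + \<beta> i) *\<^sub>R u i)"
      by (simp add: x y scaleR_add_left sum.distrib)
    then have "F (x + y) - F 0 = (\<Sum>i\<in>UNIV. f i (\<alpha> i + \<beta> i) *\<^sub>R w i)" using rep by simp
    also have "\<dots> = (\<Sum>i\<in>UNIV. f i (\<alpha> i) *\<^sub>R w i) + (\<Sum>i\<in>UNIV. f i (\<beta> i) *\<^sub>R w i)"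
      using f by (simp add: additive.add scaleR_add_left sum.distrib)
    finally show "F (x + y) - F 0 = (F x - F 0) + (F y - F 0)" using rep x y by simp
  qed
  then show ?thesis using u w f rep by blast
qed

end
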